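(* Let $\pi=\{C_1,\dots,C_k\}$ be an almost equitable partition of the connected weighted undirected graph $\mathcal{G}$. Let $S$ and $\hat S$ be the transfer functions of the single integrator leader-follower network and of the reduced network obtained by clustering according to $\pi$ (see context). For $i=1,\dots,m$ let $C_{k_i}$ be the cell of $\pi$ containing the leader $v_i$. Then $$\|S-\hat S\|_{\mathcal{H}_\infty}^2=\begin{cases}\displaystyle\max_{1\le i\le m}\left(1-\frac{1}{|C_{k_i}|}\right)&\text{if the leaders are in (pairwise) different cells},\\[2mm]1&\text{otherwise.}\end{cases}$$ Furthermore, $\|S\|_{\mathcal{H}_\infty}=1$, so that the relative and absolute $\mathcal{H}_\infty$-errors coincide, i.e. $\|S-\hat S\|_{\mathcal{H}_\infty}/\|S\|_{\mathcal{H}_\infty}=\|S-\hat S\|_{\mathcal{H}_\infty}$.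
   Context: Graph. $\mathcal{G}$ is a connected weighted undirected graph on $\mathcal{V}=\{1,\dots,N\}$ with symmetric adjacency matrix $(a_{ij})$, $a_{ij}\ge 0$, $a_{ii}=0$. Its Laplacian is $L\in\mathbb{R}^{N\times N}$ with $L_{ii}=\sum_{j}a_{ij}$ and $L_{ij}=-a_{ij}$ for $i\ne j$. The leaders are distinct nodes $v_1,\dots,v_m\in\mathcal{V}$; $M\in\mathbb{R}^{N\times m}$ has $M_{ij}=1$ if $i=v_j$ and $M_{ij}=0$ otherwise. Single integrator network: $\dot x=-Lx+Mu$, $y=Lx$, with transfer function $S(s)=L(sI_N+L)^{-1}M$. Partitions. A partition $\pi=\{C_1,\dots,C_k\}$ of $\mathcal{G}$ is a partition of $\mathcal{V}$ into nonempty pairwise disjoint cells. Its characteristic matrix $P\in\mathbb{R}^{N\times k}$ has $P_{ij}=1$ if $i\in C_j$ and $0$ otherwise. $\pi$ is almost equitable if for all $p\neq q$ the number $d_{pq}(j)=\sum_{i\in C_p}a_{ij}$ is the same for all $j\in C_q$. Reduced network: $\dot{\hat x}=-\hat L\hat x+\hat Mu$, $\hat y=LP\hat x$, where $\hat L=(P^TP)^{-1}P^TLP$ and $\hat M=(P^TP)^{-1}P^TM$; its transfer function is $\hat S(s)=LP(sI_k+\hat L)^{-1}\hat M$. Norm. For a transfer function $G$ with all poles (as a rational matrix) in the open left half plane, $\|G\|_{\mathcal{H}_\infty}=\sup_{\omega\in\mathbb{R}}\sigma_1(G(i\omega))$, where $\sigma_1$ denotes the largest singular value.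
   Formalization: The "Furthermore" part (‖S‖ = 1 and equality of relative and absolute errors) is stated only for m ≥ 2 leaders, since for a single leader ‖S‖² = 1 − 1/N < 1; the error formula is stated for all m ≥ 1. *)

theory Defs
  imports "HOL-Complex_Analysis.Complex_Analysis"
begin

text \<open>
  The finite type \<open>'n\<close> is the node set, \<open>'m\<close> indexes the leaders and \<open>'k\<close> the cells, so a matrix
  with $N$ rows and $m$ columns has type \<open>real ^ 'm ^ 'n\<close>.
\<close>

definition weighted_graph :: "real ^ 'n ^ 'n \<Rightarrow> bool" where
  "weighted_graph A \<longleftrightarrow>
     (\<forall>i j. A $ i $ j = A $ j $ i) \<and> (\<forall>i j. 0 \<le> A $ i $ j) \<and> (\<forall>i. A $ i $ i = 0)"

definition connected_graph :: "real ^ 'n ^ 'n \<Rightarrow> bool" where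
  "connected_graph A \<longleftrightarrow> (\<forall>i j. (i, j) \<in> {(p, q). A $ p $ q > 0}\<^sup>*)"

definition laplacian :: "real ^ 'n ^ 'n \<Rightarrow> real ^ 'n ^ 'n" where
  "laplacian A = (\<chi> i j. if i = j then (\<Sum>l\<in>UNIV. A $ i $ l) else - A $ i $ j)"

definition leader_matrix :: "('m::finite \<Rightarrow> 'n::finite) \<Rightarrow> real ^ 'm ^ 'n" where
  "leader_matrix v = (\<chi> i j. if i = v j then 1 else 0)"

text \<open>Injectivity says that the cells are listed without repetition.\<close>

definition is_partition :: "('k \<Rightarrow> 'n set) \<Rightarrow> bool" where
  "is_partition C \<longleftrightarrow> partition_on UNIV (range C) \<and> inj C"

definition characteristic_matrix :: "('k::finite \<Rightarrow> 'n::finite set) \<Rightarrow> real ^ 'k ^ 'n" where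
  "characteristic_matrix C = (\<chi> i j. if i \<in> C j then 1 else 0)"

definition almost_equitable :: "real ^ 'n ^ 'n \<Rightarrow> ('k \<Rightarrow> 'n::finite set) \<Rightarrow> bool" where
  "almost_equitable A C \<longleftrightarrow>
     (\<forall>p q. p \<noteq> q \<longrightarrow>
       (\<forall>j\<in>C q. \<forall>j'\<in>C q. (\<Sum>i\<in>C p. A $ i $ j) = (\<Sum>i\<in>C p. A $ i $ j')))"

definition reduced_laplacian :: "real ^ 'n ^ 'n \<Rightarrow> ('k::finite \<Rightarrow> 'n::finite set) \<Rightarrow> real ^ 'k ^ 'k" where
  "reduced_laplacian A C =
     (let P = characteristic_matrix C
      in matrix_inv (transpose P ** P) ** transpose P ** laplacian A ** P)"

definition reduced_leader_matrix :: "('k::finite \<Rightarrow> 'n::finite set) \<Rightarrow> ('m::finite \<Rightarrow> 'n) \<Rightarrow> real ^ 'm ^ 'k" where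
  "reduced_leader_matrix C v =
     (let P = characteristic_matrix C
      in matrix_inv (transpose P ** P) ** transpose P ** leader_matrix v)"

abbreviation cmat :: "real ^ 'a ^ 'b \<Rightarrow> complex ^ 'a ^ 'b" where
  "cmat \<equiv> map_matrix complex_of_real"

text \<open>
  In the next two definitions \<open>mat s\<close> is the scalar matrix $sI$. At the finitely many \<open>s\<close> where
  the matrix to be inverted is singular (among them \<open>s = 0\<close>) the value is unspecified. The notions
  below depend only on values in punctured neighbourhoods, so they see just the rational matrix.
\<close>

definition network_tf ::
  "real ^ 'n ^ 'n \<Rightarrow> ('m::finite \<Rightarrow> 'n) \<Rightarrow> complex \<Rightarrow> complex ^ 'm ^ 'n" where
  "network_tf A v s =
     cmat (laplacian A) ** matrix_inv (mat s + cmat (laplacian A)) ** cmat (leader_matrix v)"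

definition reduced_tf ::
  "real ^ 'n ^ 'n \<Rightarrow> ('k::finite \<Rightarrow> 'n::finite set) \<Rightarrow> ('m::finite \<Rightarrow> 'n) \<Rightarrow> complex \<Rightarrow> complex ^ 'm ^ 'n" where
  "reduced_tf A C v s =
     cmat (laplacian A ** characteristic_matrix C)
       ** matrix_inv (mat s + cmat (reduced_laplacian A C))
       ** cmat (reduced_leader_matrix C v)"

definition tf_stable :: "(complex \<Rightarrow> complex ^ 'm ^ 'n) \<Rightarrow> bool" where
  "tf_stable G \<longleftrightarrow> (\<forall>i j s. is_pole (\<lambda>z. G z $ i $ j) s \<longrightarrow> Re s < 0)"

text \<open>
  Value of a rational matrix at \<open>s\<close>, with common factors of numerators and denominators cancelled:
  removable singularities of the entries are filled in by their limits.
\<close>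

definition tf_value :: "(complex \<Rightarrow> complex ^ 'm ^ 'n) \<Rightarrow> complex \<Rightarrow> complex ^ 'm ^ 'n" where
  "tf_value G s = (\<chi> i j. remove_sings (\<lambda>z. G z $ i $ j) s)"

definition conj_transpose :: "complex ^ 'm ^ 'n \<Rightarrow> complex ^ 'n ^ 'm" where
  "conj_transpose B = map_matrix cnj (transpose B)"

definition is_eigenvalue :: "complex ^ 'n ^ 'n \<Rightarrow> complex \<Rightarrow> bool" where
  "is_eigenvalue B \<mu> \<longleftrightarrow> (\<exists>x. x \<noteq> 0 \<and> B *v x = \<mu> *s x)"

text \<open>
  One singular value for each column, zero included; the largest one is the same as under the
  convention that lists only as many as the smaller dimension.
\<close>

definition singular_values :: "complex ^ 'm ^ 'n \<Rightarrow> real set" where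
  "singular_values B =
     {\<sigma>. 0 \<le> \<sigma> \<and> is_eigenvalue (conj_transpose B ** B) (complex_of_real (\<sigma>\<^sup>2))}"

definition largest_singular_value :: "complex ^ 'm ^ 'n \<Rightarrow> real" where
  "largest_singular_value B = Max (singular_values B)"

text \<open>
  The supremum is taken in the extended reals, so it needs no boundedness assumption. It is the
  $\mathcal{H}_\infty$-norm only for \<open>G\<close> with \<open>tf_stable G\<close>.
\<close>

definition hinf_norm :: "(complex \<Rightarrow> complex ^ 'm ^ 'n) \<Rightarrow> ereal" where
  "hinf_norm G = (SUP \<omega>::real. ereal (largest_singular_value (tf_value G (\<i> * of_real \<omega>))))"

end

theory Submission
  imports Defs
begin

text \<open>
  Let \<open>L\<close> be the Laplacian, \<open>M\<close> the leader matrix, \<open>P\<close> the characteristic matrix of the partition and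
  $\Pi = P(P^TP)^{-1}P^T$ the orthogonal projection onto the vectors that are constant on cells. Almost
  equitability means that \<open>L\<close> preserves the range of \<open>P\<close>, so $LP = P\hat L$ and
  $P(sI+\hat L)^{-1} = (sI+L)^{-1}P$. Hence the error is
  \[ S(s) - \hat S(s) = L(sI+L)^{-1}(I-\Pi)M. \]

  The factor $L(sI+L)^{-1}$ has only a removable singularity at $s = 0$. Let \<open>Q\<close> be the projection onto
  the constant vectors, that is, the kernel of \<open>L\<close>, and $B = L + Q$. Then \<open>B\<close> is positive definite and
  $L(sI+L)^{-1} = L(sI+B)^{-1}$ wherever both sides make sense (\<open>laplacian_resolvent\<close>). The right-hand
  side is continuous on the closed right half plane, which gives stability. On the imaginary axis it is a
  contraction (\<open>norm_laplacian_resolvent_le\<close>), and at $0$ it equals $I - Q$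
  (\<open>grounded_laplacian_at_0\<close>), which fixes $(I-\Pi)M$ because $\Pi$ fixes constants. As the largest singular
  value is the operator norm (\<open>largest_singular_value_eq_onorm\<close>), the supremum over all frequencies is
  the norm of $(I-\Pi)M$, attained at $0$ (\<open>hinf_norm_error\<close>).

  The norm of $(I-\Pi)M$ is elementary (\<open>onorm_cell_residual\<close>): $M^T(I-\Pi)M$ is diagonal with entries
  $1 - 1/|C_{k_i}|$ if the leaders lie in different cells. If leaders $i \<noteq> j$ share a cell, it fixes
  $e_i - e_j$, and its norm is $1$.

  The norm of \<open>S\<close> itself is a special case. For the partition with one cell, which is almost
  equitable, the reduced transfer function vanishes, so \<open>S\<close> is the error of that reduction. All leaders
  share its cell, so the norm is $1$ as soon as there are two of them.
\<close>

(* The dollar sign denotes vector components throughout, never coefficients of power series. *)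
no_notation fps_nth (infixl "$" 75)

section \<open>The largest singular value as an operator norm\<close>

lemma of_real_scalar_mult: "complex_of_real r *s x = r *\<^sub>R x"
  by (simp add: vec_eq_iff scaleR_conv_of_real[symmetric])

text \<open>
  The inner product on \<open>complex ^ 'n\<close> used here is the real one, the real part of the Hermitian
  product. It induces the same norm, and for it too \<open>conj_transpose\<close> is the adjoint; so orthogonality
  and independence can be taken from the theory of real Euclidean spaces.
\<close>

lemma inner_conj_transpose:
  fixes B :: "complex ^ 'm::finite ^ 'n::finite"
  shows "(B *v x) \<bullet> y = x \<bullet> (conj_transpose B *v y)"
proof -
  have inner_complex_cnj: "a \<bullet> b = Re (a * cnj b)" for a b :: complex
    by (simp add: inner_complex_def)
  have "(B *v x) \<bullet> y = Re (\<Sum>i\<in>UNIV. \<Sum>j\<in>UNIV. B $ i $ j * x $ j * cnj (y $ i))"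
    by (simp add: inner_vec_def inner_complex_cnj matrix_vector_mult_def sum_distrib_right del: times_complex.sel)
  also have "\<dots> = Re (\<Sum>j\<in>UNIV. \<Sum>i\<in>UNIV. B $ i $ j * x $ j * cnj (y $ i))"
    by (subst sum.swap) simp
  also have "\<dots> = x \<bullet> (conj_transpose B *v y)"
    by (simp add: inner_vec_def inner_complex_cnj matrix_vector_mult_def conj_transpose_def
        map_matrix_def transpose_def sum_distrib_left mult.assoc mult.left_commute del: times_complex.sel)
  finally show ?thesis .
qed

lemma inner_gram:
  fixes B :: "complex ^ 'm::finite ^ 'n::finite"
  shows "x \<bullet> ((conj_transpose B ** B) *v y) = (B *v x) \<bullet> (B *v y)"
  by (simp add: inner_conj_transpose matrix_vector_mul_assoc)

lemma singular_values_alt: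
  fixes B :: "complex ^ 'm::finite ^ 'n::finite"
  shows "\<sigma> \<in> singular_values B \<longleftrightarrow>
    0 \<le> \<sigma> \<and> (\<exists>x. x \<noteq> 0 \<and> (conj_transpose B ** B) *v x = \<sigma>\<^sup>2 *\<^sub>R x)"
  by (simp add: singular_values_def is_eigenvalue_def of_real_scalar_mult del: of_real_power)

text \<open>
  Eigenvectors of the Gram matrix for distinct eigenvalues are orthogonal, and a Euclidean space has
  only finitely many pairwise orthogonal nonzero vectors.
\<close>

lemma finite_singular_values:
  fixes B :: "complex ^ 'm::finite ^ 'n::finite"
  shows "finite (singular_values B)"
proof -
  let ?H = "conj_transpose B ** B"
  have "\<exists>f. \<forall>\<sigma>\<in>singular_values B. f \<sigma> \<noteq> 0 \<and> ?H *v f \<sigma> = \<sigma>\<^sup>2 *\<^sub>R f \<sigma>"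
    by (rule bchoice) (simp add: singular_values_alt)
  then obtain f where f: "\<And>\<sigma>. \<sigma> \<in> singular_values B \<Longrightarrow> f \<sigma> \<noteq> 0 \<and> ?H *v f \<sigma> = \<sigma>\<^sup>2 *\<^sub>R f \<sigma>"
    by blast
  have orth: "f \<sigma> \<bullet> f \<tau> = 0"
    if "\<sigma> \<in> singular_values B" "\<tau> \<in> singular_values B" "\<sigma> \<noteq> \<tau>" for \<sigma> \<tau>
  proof -
    have "f \<sigma> \<bullet> (?H *v f \<tau>) = f \<tau> \<bullet> (?H *v f \<sigma>)"
      by (simp only: inner_gram inner_commute)
    then have "(\<tau>\<^sup>2 - \<sigma>\<^sup>2) * (f \<sigma> \<bullet> f \<tau>) = 0"
      using f that by (simp add: inner_commute left_diff_distrib)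
    moreover have "\<sigma>\<^sup>2 \<noteq> \<tau>\<^sup>2"
      using that by (auto simp: singular_values_def)
    ultimately show ?thesis by auto
  qed
  have inj: "inj_on f (singular_values B)"
    using orth f by (metis inj_onI inner_eq_zero_iff)
  have "pairwise orthogonal (f ` singular_values B)"
    using orth by (auto simp: pairwise_def orthogonal_def)
  then have "independent (f ` singular_values B)"
    using f by (intro pairwise_orthogonal_independent) auto
  then show ?thesis
    using independent_imp_finite finite_imageD inj by blast
qed

text \<open>
  The unit sphere is compact.
\<close>

lemma onorm_attained:
  fixes B :: "complex ^ 'm::finite ^ 'n::finite"
  obtains x where "norm x = 1" "norm (B *v x) = onorm ((*v) B)"
proof -
  have "axis undefined 1 \<in> sphere (0 :: complex ^ 'm) 1"
    by (simp add: norm_axis_1)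
  then have "sphere (0 :: complex ^ 'm) 1 \<noteq> {}" by blast
  moreover have "continuous_on (sphere 0 1) (\<lambda>x. norm (B *v x))"
    by (intro continuous_on_norm linear_continuous_on) simp
  ultimately obtain x where x: "norm x = 1" "\<And>y. norm y = 1 \<Longrightarrow> norm (B *v y) \<le> norm (B *v x)"
    using continuous_attains_sup[of "sphere (0 :: complex ^ 'm) 1" "\<lambda>x. norm (B *v x)"] by auto
  have "norm (B *v y) \<le> norm (B *v x) * norm y" for y
  proof (cases "y = 0")
    case False
    then have "norm (B *v (y /\<^sub>R norm y)) \<le> norm (B *v x)"
      by (intro x) simp
    moreover have "B *v (y /\<^sub>R norm y) = (B *v y) /\<^sub>R norm y"
      by (intro linear_cmul bounded_linear.linear) simp
    ultimately show ?thesis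
      using False by (simp add: field_simps)
  qed simp
  then have "onorm ((*v) B) \<le> norm (B *v x)" by (rule onorm_le)
  moreover have "norm (B *v x) \<le> onorm ((*v) B)"
    using onorm[of "(*v) B" x] x(1) by simp
  ultimately show thesis using that x(1) by force
qed

text \<open>
  Let \<open>x\<close> be a unit vector at which the operator norm \<open>s\<close> is attained. The quadratic form
  $s^2|y|^2 - |By|^2$ is nonnegative and vanishes at \<open>x\<close>, so its gradient $2(s^2x - B^*Bx)$ vanishes
  there, which says that \<open>x\<close> is an eigenvector. The proof makes this quantitative: a step from \<open>x\<close>
  against the gradient direction \<open>z\<close> would make the form negative unless $z = 0$.
\<close>

lemma onorm_in_singular_values:
  fixes B :: "complex ^ 'm::finite ^ 'n::finite"
  shows "onorm ((*v) B) \<in> singular_values B"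
proof -
  define s where "s = onorm ((*v) B)"
  define H where "H = conj_transpose B ** B"
  obtain x where x: "norm x = 1" "norm (B *v x) = s"
    using onorm_attained[of B] s_def by metis
  define z where "z = s\<^sup>2 *\<^sub>R x - H *v x"
  define c where "c = s\<^sup>2 * (z \<bullet> z) - (B *v z) \<bullet> (B *v z)"
  have q: "(B *v y) \<bullet> (B *v y) \<le> s\<^sup>2 * (y \<bullet> y)" for y
  proof -
    have "(norm (B *v y))\<^sup>2 \<le> (s * norm y)\<^sup>2"
      unfolding s_def by (intro power_mono onorm) simp_all
    then show ?thesis by (simp add: power_mult_distrib power2_norm_eq_inner)
  qed
  have c: "c \<ge> 0" using q[of z] by (simp add: c_def)
  have zz: "s\<^sup>2 * (x \<bullet> z) - (B *v x) \<bullet> (B *v z) = z \<bullet> z"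
  proof -
    have "(B *v x) \<bullet> (B *v z) = (H *v x) \<bullet> z"
      using inner_gram[of z B x] by (simp add: H_def inner_commute)
    then show ?thesis
      by (metis z_def inner_diff_left inner_scaleR_left)
  qed
  have xx: "s\<^sup>2 * (x \<bullet> x) = (B *v x) \<bullet> (B *v x)"
    using x by (simp add: power2_norm_eq_inner[symmetric])
  \<comment> \<open>On the line through \<open>x\<close> the form is $2t|z|^2 + ct^2$. Its minimiser $-|z|^2/c$ needs $c \<noteq> 0$,
    and dividing by $c + 1$ instead still gives a negative value.\<close>
  define t where "t = - (z \<bullet> z) / (c + 1)"
  have "0 \<le> s\<^sup>2 * ((x + t *\<^sub>R z) \<bullet> (x + t *\<^sub>R z))
            - (B *v (x + t *\<^sub>R z)) \<bullet> (B *v (x + t *\<^sub>R z))"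
    using q[of "x + t *\<^sub>R z"] by simp
  also have "B *v (x + t *\<^sub>R z) = B *v x + t *\<^sub>R (B *v z)"
    by (simp add: linear_add linear_cmul matrix_vector_mul_bounded_linear bounded_linear.linear)
  also have "s\<^sup>2 * ((x + t *\<^sub>R z) \<bullet> (x + t *\<^sub>R z))
       - (B *v x + t *\<^sub>R (B *v z)) \<bullet> (B *v x + t *\<^sub>R (B *v z))
     = 2 * t * (s\<^sup>2 * (x \<bullet> z) - (B *v x) \<bullet> (B *v z)) + t\<^sup>2 * c"
    using xx by (simp add: c_def inner_add_left inner_add_right inner_commute algebra_simps power2_eq_square)
  also have "\<dots> = - ((z \<bullet> z)\<^sup>2 * (c + 2) / (c + 1)\<^sup>2)"
  proof -
    have "2 * (- a / d) * a + (- a / d)\<^sup>2 * (d - 1) = - (a\<^sup>2 * (d + 1) / d\<^sup>2)" if "d \<noteq> 0" for a d :: real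
      using that by (simp add: divide_simps power2_eq_square) (simp add: algebra_simps)
    from this[of "c + 1" "z \<bullet> z"] show ?thesis
      using c by (simp add: zz t_def add.commute)
  qed
  finally have "(z \<bullet> z)\<^sup>2 * (c + 2) / (c + 1)\<^sup>2 \<le> 0" by simp
  then have "(z \<bullet> z)\<^sup>2 \<le> 0"
    using c by (simp add: divide_le_0_iff mult_le_0_iff)
  then have "z = 0" by simp
  then have "H *v x = s\<^sup>2 *\<^sub>R x" by (simp add: z_def)
  moreover have "s \<ge> 0" unfolding s_def by (rule onorm_pos_le) simp
  moreover have "x \<noteq> 0" using x by auto
  ultimately show ?thesis
    unfolding singular_values_alt s_def[symmetric] H_def by blast
qed

lemma largest_singular_value_eq_onorm:
  fixes B :: "complex ^ 'm::finite ^ 'n::finite"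
  shows "largest_singular_value B = onorm ((*v) B)"
  unfolding largest_singular_value_def
proof (rule Max_eqI)
  fix \<sigma> assume "\<sigma> \<in> singular_values B"
  then obtain x where x: "\<sigma> \<ge> 0" "x \<noteq> 0" "(conj_transpose B ** B) *v x = \<sigma>\<^sup>2 *\<^sub>R x"
    unfolding singular_values_alt by blast
  then have "(norm (B *v x))\<^sup>2 = (\<sigma> * norm x)\<^sup>2"
    using inner_gram[of x B x] by (simp add: power2_norm_eq_inner power_mult_distrib)
  then have "\<sigma> * norm x = norm (B *v x)"
    using x(1) by (metis mult_nonneg_nonneg norm_ge_zero power2_eq_imp_eq)
  also have "\<dots> \<le> onorm ((*v) B) * norm x" by (rule onorm) simp
  finally show "\<sigma> \<le> onorm ((*v) B)" using x(2) by simp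
qed (simp_all add: finite_singular_values onorm_in_singular_values)

section \<open>Real matrices and scalar matrices over the complex numbers\<close>

lemma cmat_nth [simp]: "cmat X $ i $ j = complex_of_real (X $ i $ j)"
  by (simp add: map_matrix_def)

lemma cmat_mult: "cmat (X ** Y) = cmat X ** cmat Y"
  by (simp add: vec_eq_iff matrix_matrix_mult_def)

lemma cmat_diff: "cmat (X - Y) = cmat X - cmat Y"
  by (simp add: vec_eq_iff)

lemma cmat_add: "cmat (X + Y) = cmat X + cmat Y"
  by (simp add: vec_eq_iff)

lemma cmat_mat_1: "cmat (mat 1) = mat 1"
  by (simp add: vec_eq_iff mat_def)

lemma cmat_0: "cmat 0 = 0"
  by (simp add: vec_eq_iff)

lemma conj_transpose_cmat: "conj_transpose (cmat X) = cmat (transpose X)"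
  by (simp add: vec_eq_iff conj_transpose_def transpose_def map_matrix_def)

lemma matrix_axis_nth: "(X *v axis l 1) $ k = X $ k $ l"
  by (simp add: matrix_vector_mult_def axis_def if_distrib[of "\<lambda>a. _ * a"] cong: if_cong)

lemma mat_vector_mult: "mat s *v x = s *s x"
  by (simp add: vec_eq_iff mat_def matrix_vector_mult_def if_distrib[of "\<lambda>a. a * _"] cong: if_cong)

lemma mat_commute: "mat s ** X = X ** mat s" for X :: "'a::comm_semiring_1 ^ 'm::finite ^ 'n::finite"
  by (simp add: vec_eq_iff mat_def matrix_matrix_mult_def mult.commute
      if_distrib[of "\<lambda>a. a * _"] if_distrib[of "\<lambda>a. _ * a"] cong: if_cong)

section \<open>Inverses of matrices and limits of rational matrices\<close>

lemma tendsto_det: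
  fixes X :: "'t \<Rightarrow> complex ^ 'n::finite ^ 'n"
  assumes "(X \<longlongrightarrow> X0) F"
  shows "((\<lambda>t. det (X t)) \<longlongrightarrow> det X0) F"
  unfolding det_def by (intro tendsto_intros assms)

lemma
  fixes X :: "'a::field ^ 'n ^ 'n"
  assumes "invertible X"
  shows matrix_inv_right: "X ** matrix_inv X = mat 1"
    and matrix_inv_left: "matrix_inv X ** X = mat 1"
  using assms someI_ex[of "\<lambda>Y. X ** Y = mat 1 \<and> Y ** X = mat 1"]
  by (auto simp: invertible_def matrix_inv_def)

lemma matrix_inv_eqI:
  fixes X :: "'a::field ^ 'n ^ 'n"
  assumes "X ** Y = mat 1"
  shows "matrix_inv X = Y"
proof -
  have "invertible X" using assms by (auto simp: invertible_right_inverse)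
  have "matrix_inv X = matrix_inv X ** (X ** Y)" using assms by simp
  also have "\<dots> = Y"
    using \<open>invertible X\<close> by (simp add: matrix_mul_assoc matrix_inv_left)
  finally show ?thesis .
qed

text \<open>
  A formula by determinants, from which continuity of inversion follows.
\<close>

lemma matrix_inv_cramer:
  fixes X :: "'a::field ^ 'n ^ 'n"
  assumes "det X \<noteq> 0"
  shows "matrix_inv X $ k $ l = det (\<chi> i j. if j = k then axis l 1 $ i else X $ i $ j) / det X"
proof -
  have "X *v (matrix_inv X *v axis l 1) = axis l 1"
    using assms by (simp add: invertible_det_nz[symmetric] matrix_vector_mul_assoc matrix_inv_right)
  then show ?thesis
    unfolding cramer[OF assms] by (simp add: vec_eq_iff matrix_axis_nth)
qed

lemma tendsto_matrix_inv:
  fixes X :: "'t \<Rightarrow> complex ^ 'n::finite ^ 'n"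
  assumes X: "(X \<longlongrightarrow> X0) F" and "det X0 \<noteq> 0"
  shows "((\<lambda>t. matrix_inv (X t)) \<longlongrightarrow> matrix_inv X0) F"
proof (intro vec_tendstoI)
  fix k l
  define N where "N Y = (\<chi> i j. if j = k then axis l 1 $ i else Y $ i $ j)" for Y :: "complex ^ 'n ^ 'n"
  have "((\<lambda>t. N (X t)) \<longlongrightarrow> N X0) F"
    unfolding N_def by (intro vec_tendstoI) (simp add: tendsto_vec_nth X)
  then have "((\<lambda>t. det (N (X t)) / det (X t)) \<longlongrightarrow> det (N X0) / det X0) F"
    by (intro tendsto_intros tendsto_det assms)
  moreover have "\<forall>\<^sub>F t in F. det (X t) \<noteq> 0"
    by (rule tendsto_imp_eventually_ne[OF tendsto_det[OF X]]) fact
  then have "\<forall>\<^sub>F t in F. matrix_inv (X t) $ k $ l = det (N (X t)) / det (X t)"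
    by eventually_elim (simp add: matrix_inv_cramer N_def)
  moreover have "matrix_inv X0 $ k $ l = det (N X0) / det X0"
    using assms by (simp add: matrix_inv_cramer N_def)
  ultimately show "((\<lambda>t. matrix_inv (X t) $ k $ l) \<longlongrightarrow> matrix_inv X0 $ k $ l) F"
    by (simp add: tendsto_cong)
qed

lemma tendsto_matrix_mult:
  fixes X :: "'t \<Rightarrow> 'a::{real_normed_field} ^ 'm::finite ^ 'n::finite" and Y :: "'t \<Rightarrow> 'a ^ 'k::finite ^ 'm"
  assumes "(X \<longlongrightarrow> X0) F" "(Y \<longlongrightarrow> Y0) F"
  shows "((\<lambda>t. X t ** Y t) \<longlongrightarrow> X0 ** Y0) F"
  unfolding matrix_matrix_mult_def
  by (intro vec_tendstoI) (auto intro!: tendsto_intros assms tendsto_vec_nth)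

lemma tendsto_mat:
  fixes f :: "'t \<Rightarrow> 'a::real_normed_field"
  assumes "(f \<longlongrightarrow> c) F"
  shows "((\<lambda>t. mat (f t) :: 'a ^ 'n::finite ^ 'n) \<longlongrightarrow> mat c) F"
  unfolding mat_def by (intro vec_tendstoI) (simp add: assms)

text \<open>
  If $XP = PY$ and \<open>P\<close> is injective, then \<open>Y\<close> is a restriction of \<open>X\<close> to an invariant subspace. So
  \<open>Y\<close> inherits invertibility, and \<open>P\<close> intertwines the inverses as well.
\<close>

lemma matrix_inv_intertwine:
  fixes X :: "'a::field ^ 'n::finite ^ 'n" and Y :: "'a ^ 'k::finite ^ 'k"
  assumes "invertible X" "G ** P = mat 1" "X ** P = P ** Y"
  shows "P ** matrix_inv Y = matrix_inv X ** P"
proof -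
  have "(G ** matrix_inv X ** P) ** Y = G ** (matrix_inv X ** X) ** P"
    by (simp add: matrix_mul_assoc[symmetric] assms(3))
  also have "\<dots> = mat 1"
    using assms(1,2) by (simp add: matrix_inv_left)
  finally have "invertible Y"
    by (auto simp: invertible_left_inverse)
  have "P ** matrix_inv Y = matrix_inv X ** X ** P ** matrix_inv Y"
    using assms(1) by (simp add: matrix_inv_left)
  also have "\<dots> = matrix_inv X ** (X ** P) ** matrix_inv Y"
    by (simp add: matrix_mul_assoc)
  also have "\<dots> = matrix_inv X ** P ** (Y ** matrix_inv Y)"
    by (simp add: matrix_mul_assoc assms(3))
  finally show ?thesis
    using \<open>invertible Y\<close> by (simp add: matrix_inv_right)
qed

text \<open>
  A limit over a full punctured neighbourhood settles both questions asked about a transfer function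
  at a point, its value with singularities removed and the absence of a pole.
\<close>

lemma tf_value_eq_limit:
  fixes G :: "complex \<Rightarrow> complex ^ 'm::finite ^ 'n::finite"
  assumes "(G \<longlongrightarrow> G0) (at s)"
  shows "tf_value G s = G0" and "\<not> is_pole (\<lambda>z. G z $ i $ j) s"
proof -
  have lim: "((\<lambda>z. G z $ i $ j) \<longlongrightarrow> G0 $ i $ j) (at s)" for i j
    by (intro tendsto_vec_nth assms)
  show "tf_value G s = G0"
    by (simp add: tf_value_def vec_eq_iff remove_sings_eqI[OF lim])
  show "\<not> is_pole (\<lambda>z. G z $ i $ j) s"
    using not_tendsto_and_filterlim_at_infinity[OF _ lim] by (auto simp: is_pole_def)
qed

section \<open>Averaging over the cells of a partition\<close>

text \<open>
  With \<open>P\<close> the characteristic matrix, this is the left inverse $(P^TP)^{-1}P^T$ of \<open>P\<close>; see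
  \<open>left_inverse_eq_cell_mean\<close>. Hence \<open>cell_projection\<close> is the orthogonal projection onto the vectors
  that are constant on each cell.
\<close>

definition cell_mean :: "('k::finite \<Rightarrow> 'n::finite set) \<Rightarrow> real ^ 'n ^ 'k" where
  "cell_mean C = (\<chi> k j. if j \<in> C k then 1 / real (card (C k)) else 0)"

definition cell_projection :: "('k::finite \<Rightarrow> 'n::finite set) \<Rightarrow> real ^ 'n ^ 'n" where
  "cell_projection C = characteristic_matrix C ** cell_mean C"

lemma cell_nonempty: "is_partition C \<Longrightarrow> C k \<noteq> {}"
  unfolding is_partition_def partition_on_def by (metis rangeI)

lemma cells_disjoint: "is_partition C \<Longrightarrow> i \<in> C p \<Longrightarrow> i \<in> C q \<longleftrightarrow> p = q"
  unfolding is_partition_def partition_on_def disjoint_def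
  by (metis disjoint_iff injD rangeI)

lemma cells_cover: "is_partition C \<Longrightarrow> \<exists>k. i \<in> C k"
  unfolding is_partition_def partition_on_def by blast

lemma transpose_cell_projection: "transpose (cell_projection C) = cell_projection C"
  by (auto simp: vec_eq_iff transpose_def cell_projection_def matrix_matrix_mult_def
      characteristic_matrix_def cell_mean_def intro!: sum.cong)

context
  fixes C :: "'k::finite \<Rightarrow> 'n::finite set"
  assumes C: "is_partition C"
begin

lemma cell_mean_characteristic: "cell_mean C ** characteristic_matrix C = mat 1"
proof -
  have "(\<Sum>j\<in>UNIV. (if j \<in> C k then 1 / real (card (C k)) else 0) * (if j \<in> C l then 1 else 0))
      = (if k = l then 1 else 0)" for k l
  proof -
    have "(\<Sum>j\<in>UNIV. (if j \<in> C k then 1 / real (card (C k)) else 0) * (if j \<in> C l then 1 else 0))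
       = (\<Sum>j\<in>UNIV. if j \<in> C k then (if k = l then 1 / real (card (C k)) else 0) else 0)"
      by (intro sum.cong) (auto simp: cells_disjoint[OF C])
    also have "\<dots> = (if k = l then 1 else 0)"
      using cell_nonempty[OF C] by (simp add: sum.If_cases)
    finally show ?thesis .
  qed
  then show ?thesis
    by (simp add: vec_eq_iff mat_def matrix_matrix_mult_def cell_mean_def characteristic_matrix_def)
qed

lemma cell_projection_fixes:
  assumes "\<And>k i j l. i \<in> C k \<Longrightarrow> j \<in> C k \<Longrightarrow> Y $ i $ l = Y $ j $ l"
  shows "cell_projection C ** Y = Y"
proof -
  define Z where "Z = (\<chi> k l. Y $ (SOME i. i \<in> C k) $ l)"
  have "(\<Sum>k\<in>UNIV. (if i \<in> C k then 1 else 0) * Z $ k $ l) = Y $ i $ l" for i l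
  proof -
    obtain q where q: "i \<in> C q" using cells_cover[OF C] by blast
    have "(\<Sum>k\<in>UNIV. (if i \<in> C k then 1 else 0) * Z $ k $ l) = (\<Sum>k\<in>UNIV. if q = k then Z $ k $ l else 0)"
      by (intro sum.cong) (auto simp: cells_disjoint[OF C q] intro: q)
    also have "\<dots> = Z $ q $ l" by simp
    also have "\<dots> = Y $ i $ l"
      unfolding Z_def vec_lambda_beta
      by (rule assms[OF someI[of "\<lambda>i. i \<in> C q", OF q] q])
    finally show ?thesis .
  qed
  then have Y: "Y = characteristic_matrix C ** Z"
    by (simp add: vec_eq_iff matrix_matrix_mult_def characteristic_matrix_def)
  have "cell_projection C ** Y
      = characteristic_matrix C ** (cell_mean C ** characteristic_matrix C) ** Z"
    unfolding Y cell_projection_def by (simp only: matrix_mul_assoc)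
  then show ?thesis by (simp add: cell_mean_characteristic Y)
qed

lemma cell_projection_idem: "cell_projection C ** cell_projection C = cell_projection C"
proof -
  have "cell_projection C ** cell_projection C
      = characteristic_matrix C ** (cell_mean C ** characteristic_matrix C) ** cell_mean C"
    by (simp only: cell_projection_def matrix_mul_assoc)
  then show ?thesis by (simp add: cell_mean_characteristic cell_projection_def)
qed

lemma cell_projection_nth:
  assumes "j \<in> C q"
  shows "cell_projection C $ i $ j = (if i \<in> C q then 1 / real (card (C q)) else 0)"
proof -
  have "cell_projection C $ i $ j
     = (\<Sum>k\<in>UNIV. (if i \<in> C k then 1 else 0) * (if j \<in> C k then 1 / real (card (C k)) else 0))"
    by (simp add: cell_projection_def matrix_matrix_mult_def characteristic_matrix_def cell_mean_def)
  also have "\<dots> = (\<Sum>k\<in>UNIV. if q = k then (if i \<in> C q then 1 / real (card (C q)) else 0) else 0)"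
    by (intro sum.cong) (auto simp: cells_disjoint[OF C assms])
  finally show ?thesis by simp
qed

text \<open>
  Write \<open>G\<close> for \<open>cell_mean C\<close>. As $GP = 1$ and $PG$ is symmetric, $GG^T$ is inverse to $P^TP$, and
  $GG^TP^T = G(PG) = G$.
\<close>

lemma left_inverse_eq_cell_mean:
  defines "P \<equiv> characteristic_matrix C"
  shows "matrix_inv (transpose P ** P) ** transpose P = cell_mean C"
proof -
  let ?G = "cell_mean C"
  have GP: "?G ** P = mat 1" unfolding P_def by (rule cell_mean_characteristic)
  have PG: "P ** ?G = transpose ?G ** transpose P"
    using transpose_cell_projection[of C] unfolding cell_projection_def P_def matrix_transpose_mul by simp
  have "transpose P ** P ** (?G ** transpose ?G) = transpose P ** (P ** ?G) ** transpose ?G"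
    by (simp only: matrix_mul_assoc)
  also have "\<dots> = transpose (?G ** P) ** transpose (?G ** P)"
    unfolding PG by (simp only: matrix_transpose_mul matrix_mul_assoc)
  finally have "transpose P ** P ** (?G ** transpose ?G) = mat 1" by (simp add: GP)
  then have "matrix_inv (transpose P ** P) = ?G ** transpose ?G"
    by (rule matrix_inv_eqI)
  then have "matrix_inv (transpose P ** P) ** transpose P = ?G ** P ** ?G"
    by (simp only: matrix_mul_assoc[symmetric] PG)
  then show ?thesis by (simp add: GP)
qed

end

text \<open>
  The projection onto the constant vectors, which span the kernel of the Laplacian of a connected
  graph. It is the cell projection for the partition with a single cell.
\<close>

definition mean_projection :: "real ^ 'n::finite ^ 'n" where
  "mean_projection = cell_projection (\<lambda>_::unit. UNIV)"

lemma is_partition_trivial: "is_partition (\<lambda>_::unit. UNIV :: 'n set)"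
  by (auto simp: is_partition_def partition_on_def disjoint_def inj_def)

lemma mean_projection_nth: "(mean_projection :: real ^ 'n::finite ^ 'n) $ i $ j = 1 / real CARD('n)"
proof -
  have "cell_projection (\<lambda>_::unit. UNIV :: 'n set) $ i $ j
      = (if i \<in> (UNIV :: 'n set) then 1 / real CARD('n) else 0)"
    by (rule cell_projection_nth[OF is_partition_trivial UNIV_I])
  then show ?thesis by (simp only: mean_projection_def UNIV_I if_True)
qed

lemma cell_projection_mean: "is_partition C \<Longrightarrow> cell_projection C ** mean_projection = mean_projection"
  by (rule cell_projection_fixes) (simp_all add: mean_projection_nth)

lemma transpose_mean_projection: "transpose mean_projection = mean_projection"
  by (simp only: mean_projection_def transpose_cell_projection)

lemma mean_cell_projection:
  assumes "is_partition C"
  shows "mean_projection ** cell_projection C = mean_projection"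
proof -
  have "mean_projection ** cell_projection C = transpose (cell_projection C ** mean_projection)"
    by (simp only: matrix_transpose_mul transpose_cell_projection transpose_mean_projection)
  then show ?thesis
    by (simp only: cell_projection_mean[OF assms] transpose_mean_projection)
qed

section \<open>The Laplacian\<close>

lemma transpose_laplacian: "weighted_graph A \<Longrightarrow> transpose (laplacian A) = laplacian A"
  by (simp add: vec_eq_iff transpose_def laplacian_def weighted_graph_def)

lemma laplacian_mult_vector_nth:
  assumes "weighted_graph A"
  shows "(cmat (laplacian A) *v x) $ i = (\<Sum>j\<in>UNIV. A $ i $ j *\<^sub>R (x $ i - x $ j))"
proof -
  have "(cmat (laplacian A) *v x) $ i
      = (\<Sum>j\<in>UNIV. (if i = j then (\<Sum>l\<in>UNIV. A $ i $ l) *\<^sub>R x $ i else 0) - A $ i $ j *\<^sub>R x $ j)"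
    using assms
    by (auto simp: matrix_vector_mult_def laplacian_def weighted_graph_def scaleR_conv_of_real
        intro!: sum.cong)
  also have "\<dots> = (\<Sum>l\<in>UNIV. A $ i $ l) *\<^sub>R x $ i - (\<Sum>j\<in>UNIV. A $ i $ j *\<^sub>R x $ j)"
    by (simp add: sum_subtractf)
  finally show ?thesis
    by (simp add: scaleR_sum_left scaleR_diff_right sum_subtractf)
qed

text \<open>
  The Dirichlet form of the graph. It gives positive semidefiniteness and, by connectivity, the kernel.
\<close>

lemma laplacian_form:
  fixes x :: "complex ^ 'n::finite"
  assumes A: "weighted_graph A"
  shows "2 * (x \<bullet> (cmat (laplacian A) *v x))
       = (\<Sum>i\<in>UNIV. \<Sum>j\<in>UNIV. A $ i $ j * (norm (x $ i - x $ j))\<^sup>2)"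
proof -
  let ?f = "\<lambda>i j. A $ i $ j * (x $ i \<bullet> (x $ i - x $ j))"
  have form: "x \<bullet> (cmat (laplacian A) *v x) = (\<Sum>i\<in>UNIV. \<Sum>j\<in>UNIV. ?f i j)"
    by (simp add: inner_vec_def laplacian_mult_vector_nth[OF A] inner_sum_right)
  also have "\<dots> = (\<Sum>i\<in>UNIV. \<Sum>j\<in>UNIV. ?f j i)"
    by (rule sum.swap)
  finally have "2 * (x \<bullet> (cmat (laplacian A) *v x)) = (\<Sum>i\<in>UNIV. \<Sum>j\<in>UNIV. ?f i j + ?f j i)"
    using form by (simp add: sum.distrib)
  also have "\<dots> = (\<Sum>i\<in>UNIV. \<Sum>j\<in>UNIV. A $ i $ j * (norm (x $ i - x $ j))\<^sup>2)"
  proof (intro sum.cong refl)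
    fix i j
    have "A $ j $ i = A $ i $ j" using A by (simp add: weighted_graph_def)
    then show "?f i j + ?f j i = A $ i $ j * (norm (x $ i - x $ j))\<^sup>2"
      by (simp add: power2_norm_eq_inner inner_diff_left inner_diff_right inner_commute algebra_simps)
  qed
  finally show ?thesis .
qed

lemma laplacian_form_nonneg:
  assumes "weighted_graph A"
  shows "0 \<le> x \<bullet> (cmat (laplacian A) *v x)"
proof -
  have "0 \<le> (\<Sum>i\<in>UNIV. \<Sum>j\<in>UNIV. A $ i $ j * (norm (x $ i - x $ j))\<^sup>2)"
    using assms by (intro sum_nonneg mult_nonneg_nonneg) (simp_all add: weighted_graph_def)
  then show ?thesis unfolding laplacian_form[OF assms, symmetric] by simp
qed

lemma laplacian_form_eq_0D:
  assumes A: "weighted_graph A" "connected_graph A"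
    and "x \<bullet> (cmat (laplacian A) *v x) = 0"
  shows "x $ i = x $ j"
proof -
  have A0: "0 \<le> A $ p $ q" for p q using A by (simp add: weighted_graph_def)
  have "(\<Sum>p\<in>UNIV. \<Sum>q\<in>UNIV. A $ p $ q * (norm (x $ p - x $ q))\<^sup>2) = 0"
    using laplacian_form[OF A(1), of x] assms(3) by simp
  then have "A $ p $ q * (norm (x $ p - x $ q))\<^sup>2 = 0" for p q
    by (simp add: sum_nonneg_eq_0_iff sum_nonneg A0)
  then have edge: "A $ p $ q > 0 \<Longrightarrow> x $ p = x $ q" for p q
    by (metis less_irrefl mult_eq_0_iff norm_eq_zero power_eq_0_iff right_minus_eq)
  have "(i, j) \<in> {(p, q). A $ p $ q > 0}\<^sup>*" using A(2) by (simp add: connected_graph_def)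
  then show ?thesis by induction (auto dest: edge)
qed

lemma laplacian_row_sum: "weighted_graph A \<Longrightarrow> (\<Sum>j\<in>UNIV. laplacian A $ i $ j) = 0"
proof -
  assume "weighted_graph A"
  then have "laplacian A $ i $ j = (if i = j then \<Sum>l\<in>UNIV. A $ i $ l else 0) - A $ i $ j" for j
    by (simp add: laplacian_def weighted_graph_def)
  then show ?thesis by (simp add: sum_subtractf)
qed

lemma laplacian_mean:
  fixes A :: "real ^ 'n::finite ^ 'n"
  assumes "weighted_graph A"
  shows "laplacian A ** mean_projection = 0"
proof -
  have "(laplacian A ** mean_projection) $ i $ j = (\<Sum>k\<in>UNIV. laplacian A $ i $ k) * (1 / real CARD('n))"
    for i j
    by (simp only: matrix_matrix_mult_def vec_lambda_beta mean_projection_nth sum_distrib_right)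
  then show ?thesis
    by (simp add: vec_eq_iff laplacian_row_sum[OF assms])
qed

lemma mean_laplacian:
  assumes "weighted_graph A"
  shows "mean_projection ** laplacian A = 0"
proof -
  have "mean_projection ** laplacian A = transpose (laplacian A ** mean_projection)"
    by (simp only: matrix_transpose_mul transpose_laplacian[OF assms] transpose_mean_projection)
  then show ?thesis
    by (simp add: laplacian_mean[OF assms] vec_eq_iff transpose_def)
qed

text \<open>
  An almost equitable partition makes the vectors that are constant on cells an invariant subspace of
  the Laplacian. The condition says directly that entry $(j,p)$ of $LP$ depends only on the cell
  of \<open>j\<close> as long as \<open>j\<close> lies outside cell \<open>p\<close>; the entries with \<open>j\<close> inside it follow because each row
  of $LP$ sums to zero.
\<close>

lemma laplacian_preserves_cells:
  assumes A: "weighted_graph A" and C: "is_partition C" and "almost_equitable A C"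
  shows "cell_projection C ** (laplacian A ** characteristic_matrix C)
       = laplacian A ** characteristic_matrix C"
proof (rule cell_projection_fixes[OF C])
  fix q i j p assume ij: "i \<in> C q" "j \<in> C q"
  let ?Y = "laplacian A ** characteristic_matrix C"
  have Y: "?Y $ i $ p = (\<Sum>l\<in>C p. laplacian A $ i $ l)" for i p
  proof -
    have "?Y $ i $ p = (\<Sum>l\<in>UNIV. if l \<in> C p then laplacian A $ i $ l else 0)"
      unfolding matrix_matrix_mult_def characteristic_matrix_def vec_lambda_beta
      by (intro sum.cong) simp_all
    then show ?thesis by (simp only: sum.If_cases[OF finite] Collect_mem_eq Int_UNIV_left sum.neutral_const add_0_right)
  qed
  have off: "?Y $ i $ p = ?Y $ j $ p" if "p \<noteq> q" for p
  proof -
    have neg: "?Y $ i $ p = - (\<Sum>l\<in>C p. A $ l $ i)" if "i \<in> C q" for i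
    proof -
      have "laplacian A $ i $ l = - A $ l $ i" if "l \<in> C p" for l
      proof -
        have "i \<noteq> l" using \<open>i \<in> C q\<close> that \<open>p \<noteq> q\<close> cells_disjoint[OF C] by metis
        moreover have "A $ i $ l = A $ l $ i" using A unfolding weighted_graph_def by blast
        ultimately show ?thesis by (simp add: laplacian_def)
      qed
      then show ?thesis unfolding Y sum_negf[symmetric] by (intro sum.cong) auto
    qed
    have "(\<Sum>l\<in>C p. A $ l $ i) = (\<Sum>l\<in>C p. A $ l $ j)"
      using assms(3) \<open>p \<noteq> q\<close> ij unfolding almost_equitable_def by blast
    then show ?thesis
      by (simp only: neg[OF ij(1)] neg[OF ij(2)])
  qed
  have disjoint: "C p \<inter> C q = {}" if "p \<noteq> q" for p q
    using cells_disjoint[OF C] that by blast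
  have total: "(\<Sum>p\<in>UNIV. ?Y $ i $ p) = 0" for i
  proof -
    have "(\<Sum>p\<in>UNIV. ?Y $ i $ p) = (\<Sum>l\<in>(\<Union>p. C p). laplacian A $ i $ l)"
      unfolding Y by (rule sum.UNION_disjoint[symmetric]) (use disjoint in auto)
    also have "(\<Union>p. C p) = UNIV" using cells_cover[OF C] by auto
    also have "(\<Sum>l\<in>UNIV. laplacian A $ i $ l) = 0" by (rule laplacian_row_sum[OF A])
    finally show ?thesis .
  qed
  have "?Y $ i $ q = - (\<Sum>p\<in>UNIV - {q}. ?Y $ i $ p)" for i
  proof -
    have "(\<Sum>p\<in>UNIV. ?Y $ i $ p) = ?Y $ i $ q + (\<Sum>p\<in>UNIV - {q}. ?Y $ i $ p)"
      by (rule sum.remove) simp_all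
    then show ?thesis using total[of i] by linarith
  qed
  moreover have "(\<Sum>p\<in>UNIV - {q}. ?Y $ i $ p) = (\<Sum>p\<in>UNIV - {q}. ?Y $ j $ p)"
    by (rule sum.cong) (use off in blast)+
  ultimately have "?Y $ i $ q = ?Y $ j $ q" by metis
  then show "?Y $ i $ p = ?Y $ j $ p" using off by metis
qed

section \<open>The grounded Laplacian and its resolvent\<close>

lemma matrix_add_rdistrib: "(X + Y) ** Z = X ** Z + Y ** Z"
  by (simp add: vec_eq_iff matrix_matrix_mult_def distrib_right sum.distrib)

lemma matrix_diff_rdistrib: "(X - Y) ** Z = X ** Z - Y ** Z" for X :: "'a::ring_1 ^ 'm ^ 'n"
  by (simp add: vec_eq_iff matrix_matrix_mult_def left_diff_distrib sum_subtractf)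

lemma matrix_diff_ldistrib: "X ** (Y - Z) = X ** Y - X ** Z" for X :: "'a::ring_1 ^ 'm ^ 'n"
  by (simp add: vec_eq_iff matrix_matrix_mult_def right_diff_distrib sum_subtractf)

lemma cmat_adjoint:
  assumes "transpose H = H"
  shows "(cmat H *v x) \<bullet> y = x \<bullet> (cmat H *v y)"
  using inner_conj_transpose[of "cmat H" x y] assms by (simp add: conj_transpose_cmat)

text \<open>
  For a symmetric \<open>H\<close> the number $y^*Hy$ is real, so a purely imaginary multiple of it has
  no real part.
\<close>

lemma imaginary_multiple_orthogonal:
  fixes H :: "real ^ 'n::finite ^ 'n"
  assumes "transpose H = H" "Re c = 0"
  shows "(c *s y) \<bullet> (cmat H *v y) = 0"
proof -
  have cnj: "cnj c = - c" using assms by (simp add: complex_eq_iff)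
  have "conj_transpose (mat c :: complex ^ 'n ^ 'n) = mat (- c)"
    by (auto simp: vec_eq_iff conj_transpose_def transpose_def map_matrix_def mat_def cnj)
  then have "(c *s y) \<bullet> (cmat H *v y) = y \<bullet> ((- c) *s (cmat H *v y))"
    using inner_conj_transpose[of "mat c" y "cmat H *v y"] by (simp add: mat_vector_mult)
  also have "\<dots> = - (y \<bullet> (cmat H *v (c *s y)))"
  proof -
    have "(- c) *s z = - (c *s z)" for z :: "complex ^ 'n" by (simp add: vec_eq_iff)
    then show ?thesis by (simp only: vector_scalar_commute inner_minus_right)
  qed
  also have "\<dots> = - ((c *s y) \<bullet> (cmat H *v y))"
    using cmat_adjoint[OF assms(1), of y "c *s y"] by (metis inner_commute)
  finally show ?thesis by simp
qed

lemma inner_scalar_mult_self: "(s *s x) \<bullet> x = Re s * (norm x)\<^sup>2" for x :: "complex ^ 'n::finite"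
proof -
  have "(s * a) \<bullet> a = Re s * (a \<bullet> a)" for a
    by (simp add: inner_complex_def algebra_simps)
  then show ?thesis
    by (simp add: inner_vec_def power2_norm_eq_inner sum_distrib_left)
qed

text \<open>
  Adding the projection onto the kernel moves the eigenvalue $0$ of the Laplacian \<open>L\<close> to $1$ and keeps
  the others. The result \<open>B\<close> is positive definite, and $L(sI+L)^{-1}$ has the continuation
  $L(sI+B)^{-1}$ across its removable singularity at $s = 0$.
\<close>

definition grounded_laplacian :: "real ^ 'n ^ 'n \<Rightarrow> real ^ 'n::finite ^ 'n" where
  "grounded_laplacian A = laplacian A + mean_projection"

lemma transpose_grounded_laplacian:
  "weighted_graph A \<Longrightarrow> transpose (grounded_laplacian A) = grounded_laplacian A"
  using transpose_laplacian[of A]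
  by (simp add: vec_eq_iff transpose_def grounded_laplacian_def mean_projection_nth)

text \<open>
  If $(sI+B)x = 0$, then the real part of $x^*(sI+B)x$ is a sum of three nonnegative terms. The vanishing
  of the Dirichlet form makes \<open>x\<close> constant, and the vanishing of its mean makes it zero.
\<close>

lemma det_shifted_grounded_laplacian:
  fixes A :: "real ^ 'n::finite ^ 'n"
  assumes A: "weighted_graph A" "connected_graph A" and s: "Re s \<ge> 0"
  shows "det (mat s + cmat (grounded_laplacian A)) \<noteq> 0"
proof -
  let ?Q = "cmat (mean_projection :: real ^ 'n ^ 'n)"
  have "x = 0" if x: "(mat s + cmat (grounded_laplacian A)) *v x = 0" for x :: "complex ^ 'n"
  proof -
    have "?Q ** ?Q = ?Q"
      by (simp add: cmat_mult[symmetric] mean_projection_def cell_projection_idem is_partition_trivial)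
    then have "x \<bullet> (?Q *v x) = (?Q *v x) \<bullet> (?Q *v x)"
      using cmat_adjoint[of mean_projection x "?Q *v x"]
      by (simp add: matrix_vector_mul_assoc mean_projection_def transpose_cell_projection)
    moreover have "0 = Re s * (norm x)\<^sup>2 + x \<bullet> (cmat (laplacian A) *v x) + x \<bullet> (?Q *v x)"
      using arg_cong[OF x, of "\<lambda>y. x \<bullet> y"] inner_scalar_mult_self[of s x]
      by (simp add: grounded_laplacian_def cmat_add matrix_vector_mult_add_rdistrib mat_vector_mult
          inner_add_right inner_commute)
    moreover have "0 \<le> Re s * (norm x)\<^sup>2" using s by simp
    moreover note laplacian_form_nonneg[OF A(1), of x]
    ultimately have form0: "x \<bullet> (cmat (laplacian A) *v x) = 0" and "(?Q *v x) \<bullet> (?Q *v x) = 0"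
      using inner_ge_zero[of "?Q *v x"] by linarith+
    then have Qx: "?Q *v x = 0" by simp
    have const: "x $ i = x $ j" for i j
      by (rule laplacian_form_eq_0D[OF A form0])
    have "(?Q *v x) $ i = x $ i" for i
    proof -
      have "(?Q *v x) $ i = (\<Sum>j\<in>(UNIV :: 'n set). complex_of_real (1 / real CARD('n)) * x $ i)"
        unfolding matrix_vector_mult_def vec_lambda_beta cmat_nth mean_projection_nth
        by (intro sum.cong arg_cong2[of _ _ _ _ "(*)"] const refl)
      then show ?thesis by simp
    qed
    then show ?thesis using Qx by (simp add: vec_eq_iff)
  qed
  then show ?thesis
    by (simp add: invertible_det_nz[symmetric] invertible_left_inverse matrix_left_invertible_ker)
qed

text \<open>
  With \<open>Q\<close> the projection onto constants and $R = (sI+B)^{-1}$, the inverse of $sI+L$ is $R + s^{-1}QR$,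
  since $(sI+L)Q = sQ$ and $sI+L+Q = sI+B$. The second summand is killed by \<open>L\<close>.
\<close>

lemma laplacian_resolvent:
  fixes A :: "real ^ 'n::finite ^ 'n"
  assumes A: "weighted_graph A" and s: "s \<noteq> 0"
    and det: "det (mat s + cmat (grounded_laplacian A)) \<noteq> 0"
  shows "invertible (mat s + cmat (laplacian A))"
    and "cmat (laplacian A) ** matrix_inv (mat s + cmat (laplacian A))
       = cmat (laplacian A) ** matrix_inv (mat s + cmat (grounded_laplacian A))"
proof -
  let ?L = "cmat (laplacian A)" and ?Q = "cmat (mean_projection :: real ^ 'n ^ 'n)"
  let ?B = "cmat (grounded_laplacian A)"
  define R where "R = matrix_inv (mat s + ?B)"
  have R: "(mat s + ?B) ** R = mat 1"
    unfolding R_def using det by (intro matrix_inv_right) (simp add: invertible_det_nz)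
  have LQ: "?L ** ?Q = 0"
    by (simp add: cmat_mult[symmetric] laplacian_mean[OF A] cmat_0)
  have ss: "mat s ** mat (1 / s) = (mat 1 :: complex ^ 'n ^ 'n)"
    using s by (simp add: vec_eq_iff mat_def matrix_matrix_mult_def if_distrib[of "\<lambda>a. a * _"] cong: if_cong)
  have LsQ: "?L ** (mat (1 / s) ** ?Q) = 0"
    by (simp add: mat_commute LQ matrix_mul_assoc)
  have "(mat s + ?L) ** (mat (1 / s) ** ?Q) = ?Q"
    by (simp add: matrix_add_rdistrib LsQ) (simp add: matrix_mul_assoc ss)
  then have "(mat s + ?L) ** (R + mat (1 / s) ** ?Q ** R) = (mat s + ?L) ** R + ?Q ** R"
    by (simp add: matrix_add_ldistrib matrix_mul_assoc)
  also have "\<dots> = mat 1"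
    using R by (simp add: grounded_laplacian_def cmat_add matrix_add_rdistrib add.assoc)
  finally have inv: "(mat s + ?L) ** (R + mat (1 / s) ** ?Q ** R) = mat 1" .
  then show "invertible (mat s + ?L)"
    by (auto simp: invertible_right_inverse)
  have "?L ** (mat (1 / s) ** ?Q ** R) = 0"
    using LsQ by (simp add: matrix_mul_assoc)
  then show "?L ** matrix_inv (mat s + ?L) = ?L ** matrix_inv (mat s + ?B)"
    unfolding matrix_inv_eqI[OF inv] R_def[symmetric] by (simp add: matrix_add_ldistrib)
qed

text \<open>
  Here $LB^{-1} = (B-Q)B^{-1} = I - QB^{-1}$, and $QB = Q$.
\<close>

lemma grounded_laplacian_at_0:
  fixes A :: "real ^ 'n::finite ^ 'n"
  assumes A: "weighted_graph A" "connected_graph A"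
  shows "cmat (laplacian A) ** matrix_inv (mat 0 + cmat (grounded_laplacian A))
       = cmat (mat 1 - mean_projection)"
proof -
  let ?B = "cmat (grounded_laplacian A)" and ?Q = "mean_projection :: real ^ 'n ^ 'n"
  define R where "R = matrix_inv (mat 0 + ?B)"
  have "?B ** R = mat 1"
    using matrix_inv_right[of "mat 0 + ?B"] det_shifted_grounded_laplacian[OF A, of 0]
    by (simp add: R_def invertible_det_nz mat_0)
  moreover have "?Q ** grounded_laplacian A = ?Q"
    by (simp add: grounded_laplacian_def matrix_add_ldistrib mean_laplacian[OF A(1)])
       (simp add: mean_projection_def cell_projection_idem is_partition_trivial)
  then have "cmat ?Q ** ?B = cmat ?Q" by (simp add: cmat_mult[symmetric])
  ultimately have "cmat ?Q ** R = cmat ?Q"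
    by (metis matrix_mul_assoc matrix_mul_rid)
  moreover have "cmat (laplacian A) ** R + cmat ?Q ** R = mat 1"
    using \<open>?B ** R = mat 1\<close> by (simp add: grounded_laplacian_def cmat_add matrix_add_rdistrib)
  ultimately show ?thesis
    unfolding R_def[symmetric] by (simp add: cmat_diff cmat_mat_1 eq_diff_eq)
qed

text \<open>
  On the imaginary axis the resolvent is handled without diagonalising \<open>L\<close>. If $w = sy + By$, the two
  summands are orthogonal, so $|By| \<le> |w|$; moreover $By = Ly + Qy$ is an orthogonal sum, so
  $|Ly| \<le> |By|$.
\<close>

lemma norm_laplacian_resolvent_le:
  fixes A :: "real ^ 'n::finite ^ 'n"
  assumes A: "weighted_graph A" "connected_graph A" and s: "Re s = 0"
  shows "norm (cmat (laplacian A) *v (matrix_inv (mat s + cmat (grounded_laplacian A)) *v w)) \<le> norm w"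
proof -
  let ?L = "cmat (laplacian A)" and ?B = "cmat (grounded_laplacian A)"
  let ?Q = "cmat (mean_projection :: real ^ 'n ^ 'n)"
  define y where "y = matrix_inv (mat s + ?B) *v w"
  have "(mat s + ?B) *v y = w"
    using det_shifted_grounded_laplacian[OF A, of s] s
    by (simp add: y_def matrix_vector_mul_assoc invertible_det_nz[symmetric] matrix_inv_right)
  then have w: "w = s *s y + ?B *v y"
    by (simp add: matrix_vector_mult_add_rdistrib mat_vector_mult)
  have "?L *v (?Q *v y) = 0"
    by (simp add: matrix_vector_mul_assoc cmat_mult[symmetric] laplacian_mean[OF A(1)] cmat_0)
  then have LQ: "(?L *v y) \<bullet> (?Q *v y) = 0"
    by (simp add: cmat_adjoint transpose_laplacian[OF A(1)])
  have By: "?B *v y = ?L *v y + ?Q *v y"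
    by (simp add: grounded_laplacian_def cmat_add matrix_vector_mult_add_rdistrib)
  have "(norm (?L *v y))\<^sup>2 \<le> (norm (?L *v y))\<^sup>2 + (norm (?Q *v y))\<^sup>2" by simp
  also have "\<dots> = (norm (?B *v y))\<^sup>2"
    unfolding By using LQ norm_add_Pythagorean[of "?L *v y" "?Q *v y"] by (simp add: orthogonal_def)
  also have "\<dots> \<le> (norm (s *s y))\<^sup>2 + (norm (?B *v y))\<^sup>2" by simp
  also have "\<dots> = (norm w)\<^sup>2"
    unfolding w using imaginary_multiple_orthogonal[OF transpose_grounded_laplacian[OF A(1)] s, of y]
    by (subst norm_add_Pythagorean) (simp_all add: orthogonal_def)
  finally show ?thesis
    unfolding y_def by (rule power2_le_imp_le) simp
qed

section \<open>The error transfer function\<close>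

lemma reduced_tf_eq:
  fixes A :: "real ^ 'n::finite ^ 'n" and C :: "'k::finite \<Rightarrow> 'n set" and v :: "'m::finite \<Rightarrow> 'n"
  assumes A: "weighted_graph A" and C: "is_partition C" "almost_equitable A C"
    and inv: "invertible (mat s + cmat (laplacian A))"
  shows "reduced_tf A C v s = cmat (laplacian A) ** matrix_inv (mat s + cmat (laplacian A))
           ** cmat (cell_projection C ** leader_matrix v)"
proof -
  let ?L = "laplacian A" and ?P = "characteristic_matrix C" and ?G = "cell_mean C"
  have L': "reduced_laplacian A C = ?G ** ?L ** ?P"
    and M': "reduced_leader_matrix C v = ?G ** leader_matrix v"
    by (simp_all only: reduced_laplacian_def reduced_leader_matrix_def Let_def left_inverse_eq_cell_mean[OF C(1)])
  have "?P ** reduced_laplacian A C = cell_projection C ** (?L ** ?P)"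
    by (simp only: L' cell_projection_def matrix_mul_assoc)
  then have LP: "?L ** ?P = ?P ** reduced_laplacian A C"
    by (simp only: laplacian_preserves_cells[OF A C])
  have "cmat ?P ** matrix_inv (mat s + cmat (reduced_laplacian A C))
      = matrix_inv (mat s + cmat ?L) ** cmat ?P"
  proof (rule matrix_inv_intertwine[OF inv])
    show "cmat ?G ** cmat ?P = mat 1"
      by (simp only: cmat_mult[symmetric] cell_mean_characteristic[OF C(1)] cmat_mat_1)
    show "(mat s + cmat ?L) ** cmat ?P = cmat ?P ** (mat s + cmat (reduced_laplacian A C))"
      by (simp only: matrix_add_rdistrib matrix_add_ldistrib cmat_mult[symmetric] LP mat_commute)
  qed
  then have "cmat ?L ** (cmat ?P ** matrix_inv (mat s + cmat (reduced_laplacian A C))) ** (cmat ?G ** cmat (leader_matrix v))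
      = cmat ?L ** (matrix_inv (mat s + cmat ?L) ** cmat ?P) ** (cmat ?G ** cmat (leader_matrix v))"
    by (simp only:)
  then show ?thesis
    unfolding reduced_tf_def M' cell_projection_def cmat_mult by (simp only: matrix_mul_assoc)
qed

text \<open>
  The part of the leader inputs that the partition does not see.
\<close>

definition cell_residual :: "('k::finite \<Rightarrow> 'n::finite set) \<Rightarrow> ('m::finite \<Rightarrow> 'n) \<Rightarrow> real ^ 'm ^ 'n" where
  "cell_residual C v = leader_matrix v - cell_projection C ** leader_matrix v"

lemma error_tf_eq:
  fixes A :: "real ^ 'n::finite ^ 'n" and C :: "'k::finite \<Rightarrow> 'n set" and v :: "'m::finite \<Rightarrow> 'n"
  assumes A: "weighted_graph A" and C: "is_partition C" "almost_equitable A C"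
    and s: "s \<noteq> 0" "det (mat s + cmat (grounded_laplacian A)) \<noteq> 0"
  shows "network_tf A v s - reduced_tf A C v s
       = cmat (laplacian A) ** matrix_inv (mat s + cmat (grounded_laplacian A)) ** cmat (cell_residual C v)"
proof -
  note res = laplacian_resolvent[OF A s]
  show ?thesis
    unfolding reduced_tf_eq[OF A C res(1)] network_tf_def res(2) cell_residual_def cmat_diff
    by (rule matrix_diff_ldistrib[symmetric])
qed

lemma tendsto_error_tf:
  fixes A :: "real ^ 'n::finite ^ 'n" and C :: "'k::finite \<Rightarrow> 'n set" and v :: "'m::finite \<Rightarrow> 'n"
  assumes A: "weighted_graph A" "connected_graph A" and C: "is_partition C" "almost_equitable A C"
    and s: "Re s \<ge> 0"
  shows "((\<lambda>s. network_tf A v s - reduced_tf A C v s) \<longlongrightarrow>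
     cmat (laplacian A) ** matrix_inv (mat s + cmat (grounded_laplacian A)) ** cmat (cell_residual C v)) (at s)"
    (is "(?E \<longlongrightarrow> ?F s) (at s)")
proof -
  let ?B = "cmat (grounded_laplacian A)"
  have B: "((\<lambda>s. mat s + ?B) \<longlongrightarrow> mat s + ?B) (at s)"
    by (intro tendsto_add tendsto_mat tendsto_ident_at tendsto_const)
  have det: "det (mat s + ?B) \<noteq> 0"
    by (rule det_shifted_grounded_laplacian[OF A s])
  have "(?F \<longlongrightarrow> ?F s) (at s)"
    by (intro tendsto_matrix_mult tendsto_matrix_inv B det tendsto_const)
  moreover have "\<forall>\<^sub>F z in at s. z \<noteq> 0"
    by (rule eventually_neq_at_within)
  moreover have "\<forall>\<^sub>F z in at s. det (mat z + ?B) \<noteq> 0"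
    by (rule tendsto_imp_eventually_ne[OF tendsto_det[OF B] det])
  then have "\<forall>\<^sub>F z in at s. ?E z = ?F z"
    using calculation(2) by eventually_elim (rule error_tf_eq[OF A(1) C])
  ultimately show ?thesis by (simp add: tendsto_cong)
qed

text \<open>
  On the imaginary axis the factor $L(sI+B)^{-1}$ of the error is a contraction, and at $s = 0$ it is the
  projection $I - Q$, which fixes the residual because the residual has mean zero. So the supremum is
  attained at frequency $0$.
\<close>

lemma hinf_norm_error:
  fixes A :: "real ^ 'n::finite ^ 'n" and C :: "'k::finite \<Rightarrow> 'n set" and v :: "'m::finite \<Rightarrow> 'n"
  assumes A: "weighted_graph A" "connected_graph A" and C: "is_partition C" "almost_equitable A C"
  defines "E \<equiv> \<lambda>s. network_tf A v s - reduced_tf A C v s"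
  shows "tf_stable E" and "hinf_norm E = ereal (onorm ((*v) (cmat (cell_residual C v))))"
proof -
  let ?B = "cmat (grounded_laplacian A)" and ?L = "cmat (laplacian A)"
  let ?W = "cmat (cell_residual C v)"
  note lim = tendsto_error_tf[OF A C, of _ v, folded E_def]
  show "tf_stable E"
    unfolding tf_stable_def using tf_value_eq_limit(2)[OF lim] by (meson not_le)
  have sv: "largest_singular_value (tf_value E s) = onorm ((*v) (?L ** matrix_inv (mat s + ?B) ** ?W))"
    if "Re s = 0" for s
    using tf_value_eq_limit(1)[OF lim] that by (simp add: largest_singular_value_eq_onorm)
  show "hinf_norm E = ereal (onorm ((*v) ?W))"
    unfolding hinf_norm_def
  proof (intro antisym SUP_least)
    fix \<omega> :: real
    let ?s = "\<i> * of_real \<omega>"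
    have "onorm ((*v) (?L ** matrix_inv (mat ?s + ?B) ** ?W)) \<le> onorm ((*v) ?W)"
    proof (rule onorm_le)
      fix x
      have "norm (?L *v (matrix_inv (mat ?s + ?B) *v (?W *v x))) \<le> norm (?W *v x)"
        by (rule norm_laplacian_resolvent_le[OF A]) simp
      also have "\<dots> \<le> onorm ((*v) ?W) * norm x" by (rule onorm) simp
      finally show "norm ((?L ** matrix_inv (mat ?s + ?B) ** ?W) *v x) \<le> onorm ((*v) ?W) * norm x"
        by (simp only: matrix_vector_mul_assoc matrix_mul_assoc)
    qed
    then show "ereal (largest_singular_value (tf_value E ?s)) \<le> ereal (onorm ((*v) ?W))"
      by (simp add: sv)
  next
    have "mean_projection ** cell_residual C v = 0"
      by (simp add: cell_residual_def matrix_diff_ldistrib matrix_mul_assoc mean_cell_projection[OF C(1)])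
    then have "(mat 1 - mean_projection) ** cell_residual C v = cell_residual C v"
      by (simp add: matrix_diff_rdistrib)
    then have "?L ** matrix_inv (mat 0 + ?B) ** ?W = ?W"
      by (simp only: grounded_laplacian_at_0[OF A] cmat_mult[symmetric])
    then have "ereal (onorm ((*v) ?W)) = ereal (largest_singular_value (tf_value E (\<i> * of_real 0)))"
      using sv[of 0] by simp
    also have "\<dots> \<le> (SUP \<omega>::real. ereal (largest_singular_value (tf_value E (\<i> * of_real \<omega>))))"
      by (rule SUP_upper) simp
    finally show "ereal (onorm ((*v) ?W)) \<le> (SUP \<omega>::real. ereal (largest_singular_value (tf_value E (\<i> * of_real \<omega>))))" .
  qed
qed

section \<open>The norm of the residual\<close>

lemma matrix_leader_nth: "(X ** leader_matrix v) $ a $ j = X $ a $ v j"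
  by (simp add: matrix_matrix_mult_def leader_matrix_def if_distrib[of "\<lambda>a. _ * a"] cong: if_cong)

lemma transpose_leader_matrix_nth: "(transpose (leader_matrix v) ** X) $ i $ j = X $ v i $ j"
  by (simp add: matrix_matrix_mult_def leader_matrix_def transpose_def
      if_distrib[of "\<lambda>a. a * _"] cong: if_cong)

text \<open>
  With \<open>M\<close> the leader matrix and $\Pi$ the cell projection, $|(I-\Pi)Mx|^2 = |Mx|^2 - |\Pi Mx|^2$, and
  \<open>M\<close> is an isometry because the leaders are distinct. The sum is $x^*Tx$ for $T = M^T\Pi M$, the
  compression of $\Pi$ to the leaders.
\<close>

lemma norm_cell_residual:
  fixes C :: "'k::finite \<Rightarrow> 'n::finite set" and v :: "'m::finite \<Rightarrow> 'n"
  assumes C: "is_partition C" and v: "inj v"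
  defines "T \<equiv> \<lambda>i j. cell_projection C $ v i $ v j"
  shows "(norm (cmat (cell_residual C v) *v x))\<^sup>2
       = (norm x)\<^sup>2 - (\<Sum>i\<in>UNIV. \<Sum>j\<in>UNIV. T i j * (x $ i \<bullet> x $ j))"
    and "(norm (cmat (cell_residual C v) *v x))\<^sup>2 \<le> (norm x)\<^sup>2"
proof -
  let ?M = "cmat (leader_matrix v)" and ?\<Pi> = "cmat (cell_projection C)"
  define y where "y = ?M *v x"
  have res: "cmat (cell_residual C v) *v x = y - ?\<Pi> *v y"
    by (simp add: cell_residual_def cmat_diff cmat_mult matrix_vector_mult_diff_rdistrib y_def
        matrix_vector_mul_assoc)
  have "?\<Pi> *v (?\<Pi> *v y) = ?\<Pi> *v y"
    by (simp only: matrix_vector_mul_assoc cmat_mult[symmetric] cell_projection_idem[OF C])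
  then have idem: "y \<bullet> (?\<Pi> *v y) = (?\<Pi> *v y) \<bullet> (?\<Pi> *v y)"
    using cmat_adjoint[OF transpose_cell_projection, of C y "?\<Pi> *v y"] by simp
  have "transpose (leader_matrix v) ** leader_matrix v = mat 1"
  proof -
    have "leader_matrix v $ v i $ j = mat 1 $ i $ j" for i j
      using v by (simp add: leader_matrix_def mat_def inj_eq)
    then show ?thesis by (simp add: vec_eq_iff transpose_leader_matrix_nth)
  qed
  then have MM: "conj_transpose ?M ** ?M = mat 1"
    by (simp only: conj_transpose_cmat cmat_mult[symmetric] cmat_mat_1)
  have yy: "y \<bullet> y = x \<bullet> x"
    using inner_gram[of x ?M x] by (simp add: MM y_def)
  have "y \<bullet> (?\<Pi> *v y) = x \<bullet> (conj_transpose ?M *v (?\<Pi> *v (?M *v x)))"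
    by (simp add: y_def inner_conj_transpose)
  also have "\<dots> = x \<bullet> (cmat (\<chi> i j. T i j) *v x)"
  proof -
    have "(\<chi> i j. T i j) = transpose (leader_matrix v) ** (cell_projection C ** leader_matrix v)"
      by (simp add: vec_eq_iff transpose_leader_matrix_nth matrix_leader_nth T_def)
    then show ?thesis
      by (simp only: conj_transpose_cmat cmat_mult matrix_vector_mul_assoc matrix_mul_assoc)
  qed
  also have "\<dots> = (\<Sum>i\<in>UNIV. \<Sum>j\<in>UNIV. T i j * (x $ i \<bullet> x $ j))"
    by (simp add: inner_vec_def matrix_vector_mult_def inner_sum_right scaleR_conv_of_real[symmetric])
  finally have form: "y \<bullet> (?\<Pi> *v y) = (\<Sum>i\<in>UNIV. \<Sum>j\<in>UNIV. T i j * (x $ i \<bullet> x $ j))" .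
  have norm: "(norm (cmat (cell_residual C v) *v x))\<^sup>2 = (norm x)\<^sup>2 - y \<bullet> (?\<Pi> *v y)"
    using idem yy unfolding res power2_norm_eq_inner
    by (simp add: inner_diff_left inner_diff_right inner_commute)
  show "(norm (cmat (cell_residual C v) *v x))\<^sup>2
       = (norm x)\<^sup>2 - (\<Sum>i\<in>UNIV. \<Sum>j\<in>UNIV. T i j * (x $ i \<bullet> x $ j))"
    using norm form by simp
  show "(norm (cmat (cell_residual C v) *v x))\<^sup>2 \<le> (norm x)\<^sup>2"
    using norm idem inner_ge_zero[of "?\<Pi> *v y"] by linarith
qed

lemma onorm_sq_eqI:
  fixes X :: "complex ^ 'm::finite ^ 'n::finite"
  assumes le: "\<And>x. (norm (X *v x))\<^sup>2 \<le> r * (norm x)\<^sup>2"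
    and eq: "x0 \<noteq> 0" "(norm (X *v x0))\<^sup>2 = r * (norm x0)\<^sup>2"
  shows "(onorm ((*v) X))\<^sup>2 = r"
proof (rule antisym)
  have "0 \<le> r * (norm x0)\<^sup>2" unfolding eq(2)[symmetric] by simp
  then have r: "0 \<le> r" using eq(1) by (simp add: zero_le_mult_iff)
  have "onorm ((*v) X) \<le> sqrt r"
  proof (rule onorm_le)
    fix x
    show "norm (X *v x) \<le> sqrt r * norm x"
      by (rule power2_le_imp_le) (use le[of x] r in \<open>simp_all add: power_mult_distrib\<close>)
  qed
  moreover have "0 \<le> onorm ((*v) X)" by (rule onorm_pos_le) simp
  ultimately have "(onorm ((*v) X))\<^sup>2 \<le> (sqrt r)\<^sup>2" by (rule power_mono)
  then show "(onorm ((*v) X))\<^sup>2 \<le> r" using r by simp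
  have "(norm (X *v x0))\<^sup>2 \<le> (onorm ((*v) X) * norm x0)\<^sup>2"
    by (intro power_mono onorm) simp_all
  then have "r * (norm x0)\<^sup>2 \<le> (onorm ((*v) X))\<^sup>2 * (norm x0)\<^sup>2"
    by (simp add: eq(2) power_mult_distrib)
  then show "r \<le> (onorm ((*v) X))\<^sup>2" using eq(1) by simp
qed

text \<open>
  Two leaders contribute to the quadratic form of the residual jointly only if they share a cell. If
  none do, the form is diagonal with entries $1 - 1/|C_{k_i}|$. If leaders $i \<noteq> j$ do, the input
  $e_i - e_j$ has mean zero on every cell and so passes to the residual unchanged.
\<close>

lemma onorm_cell_residual:
  fixes C :: "'k::finite \<Rightarrow> 'n::finite set" and v :: "'m::finite \<Rightarrow> 'n" and \<kappa> :: "'m \<Rightarrow> 'k"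
  assumes C: "is_partition C" and v: "inj v" "\<And>i. v i \<in> C (\<kappa> i)"
  shows "(onorm ((*v) (cmat (cell_residual C v))))\<^sup>2
       = (if inj \<kappa> then (MAX i. 1 - 1 / real (card (C (\<kappa> i)))) else 1)"
proof -
  let ?W = "cmat (cell_residual C v)"
  define T where "T i j = cell_projection C $ v i $ v j" for i j
  have T: "T i j = (if \<kappa> i = \<kappa> j then 1 / real (card (C (\<kappa> j))) else 0)" for i j
    using cells_disjoint[OF C v(2)[of i]] by (simp add: T_def cell_projection_nth[OF C v(2)])
  note norm_W = norm_cell_residual[OF C v(1), folded T_def]
  show ?thesis
  proof (cases "inj \<kappa>")
    case True
    define g where "g i = 1 - 1 / real (card (C (\<kappa> i)))" for i
    have W: "(norm (?W *v x))\<^sup>2 = (\<Sum>i\<in>UNIV. g i * (norm (x $ i))\<^sup>2)" for x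
    proof -
      have T: "T i j * c = (if i = j then 1 / real (card (C (\<kappa> i))) * c else 0)" for i j c
        using True by (auto simp: T inj_eq)
      have "(norm (?W *v x))\<^sup>2 = (norm x)\<^sup>2 - (\<Sum>i\<in>UNIV. 1 / real (card (C (\<kappa> i))) * (x $ i \<bullet> x $ i))"
        by (simp add: norm_W(1) T)
      also have "(norm x)\<^sup>2 = (\<Sum>i\<in>UNIV. x $ i \<bullet> x $ i)"
        by (simp add: power2_norm_eq_inner inner_vec_def)
      finally show ?thesis
        by (simp add: g_def left_diff_distrib sum_subtractf power2_norm_eq_inner)
    qed
    have "Max (range g) \<in> range g" by (rule Max_in) auto
    then obtain k where k: "Max (range g) = g k" by blast
    have "(onorm ((*v) ?W))\<^sup>2 = Max (range g)"
    proof (rule onorm_sq_eqI)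
      fix x :: "complex ^ 'm"
      have "(\<Sum>i\<in>UNIV. g i * (norm (x $ i))\<^sup>2) \<le> (\<Sum>i\<in>UNIV. Max (range g) * (norm (x $ i))\<^sup>2)"
        by (intro sum_mono mult_right_mono) auto
      also have "\<dots> = Max (range g) * (norm x)\<^sup>2"
        by (simp add: sum_distrib_left[symmetric] norm_vec_def L2_set_def sum_nonneg)
      finally show "(norm (?W *v x))\<^sup>2 \<le> Max (range g) * (norm x)\<^sup>2" by (simp only: W)
    next
      have "(\<Sum>i\<in>UNIV. g i * (norm (axis k 1 $ i :: complex))\<^sup>2) = (\<Sum>i\<in>UNIV. if k = i then g k else 0)"
        by (intro sum.cong) (auto simp: axis_def)
      then show "(norm (?W *v axis k 1))\<^sup>2 = Max (range g) * (norm (axis k 1 :: complex ^ 'm))\<^sup>2"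
        by (simp add: W k norm_axis_1)
    qed (simp add: axis_eq_0_iff)
    then show ?thesis using True by (simp add: g_def)
  next
    case False
    then obtain i j where ij: "i \<noteq> j" "\<kappa> i = \<kappa> j" by (auto simp: inj_def)
    define x where "x = (axis i 1 - axis j 1 :: complex ^ 'm)"
    have "(onorm ((*v) ?W))\<^sup>2 = 1"
    proof (rule onorm_sq_eqI)
      show "x \<noteq> 0" using ij by (auto simp: x_def axis_eq_axis)
      have "(\<Sum>l\<in>UNIV. T k l * (x $ k \<bullet> x $ l)) = 0" for k
      proof -
        have "T k i = T k j" using ij by (simp add: T)
        have "(\<Sum>l\<in>UNIV. T k l * (x $ k \<bullet> x $ l))
            = (\<Sum>l\<in>UNIV. (if i = l then T k i * (x $ k \<bullet> 1) else 0) - (if j = l then T k j * (x $ k \<bullet> 1) else 0))"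
          using ij(1) by (intro sum.cong) (auto simp: x_def axis_def)
        also have "\<dots> = 0" using \<open>T k i = T k j\<close> by (simp add: sum_subtractf)
        finally show ?thesis .
      qed
      then show "(norm (?W *v x))\<^sup>2 = 1 * (norm x)\<^sup>2"
        by (simp add: norm_W(1))
    qed (simp add: norm_W(2))
    then show ?thesis using False by simp
  qed
qed

text \<open>
  The output of the reduced network for the one-cell partition is \<open>L\<close> applied to constants. Hence the
  original network is itself the error of this reduction, and statements about errors apply to it.
\<close>

lemma reduced_tf_trivial:
  fixes A :: "real ^ 'n::finite ^ 'n"
  assumes "weighted_graph A"
  shows "reduced_tf A (\<lambda>_::unit. UNIV) v s = 0"
proof -
  have "laplacian A ** characteristic_matrix (\<lambda>_::unit. UNIV) = 0"
    using laplacian_row_sum[OF assms]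
    by (simp add: vec_eq_iff matrix_matrix_mult_def characteristic_matrix_def)
  then show ?thesis by (simp add: reduced_tf_def cmat_0)
qed

section \<open>Stability and norms of the network and of the reduction error\<close>

theorem theorem13:
  fixes A :: "real ^ 'n ^ 'n"
    and v :: "'m::finite \<Rightarrow> 'n"
    and C :: "'k::finite \<Rightarrow> 'n set"
    and \<kappa> :: "'m \<Rightarrow> 'k"
  assumes "weighted_graph A" and "connected_graph A"
    and "inj v"
    and "is_partition C" and "almost_equitable A C"
    and "\<And>i. v i \<in> C (\<kappa> i)"
  shows
    "let S = network_tf A v;
         E = (\<lambda>s. network_tf A v s - reduced_tf A C v s)
     in tf_stable S \<and> tf_stable E \<and>
        (hinf_norm E)\<^sup>2 =
          ereal (if inj \<kappa> then (MAX i. 1 - 1 / real (card (C (\<kappa> i)))) else 1) \<and>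
        (CARD('m) \<ge> 2 \<longrightarrow>
          hinf_norm S = 1 \<and> hinf_norm E / hinf_norm S = hinf_norm E)"
proof -
  define E where "E = (\<lambda>s. network_tf A v s - reduced_tf A C v s)"
  define S where "S = network_tf A v"
  let ?U = "\<lambda>_::unit. UNIV :: 'n set"
  note graph = assms(1,2)
  have S: "S = (\<lambda>s. network_tf A v s - reduced_tf A ?U v s)"
    by (simp add: S_def reduced_tf_trivial[OF assms(1)])
  have U: "is_partition ?U" "almost_equitable A ?U"
    by (rule is_partition_trivial) (simp add: almost_equitable_def)
  note E_norm = hinf_norm_error[OF graph assms(4,5), of v, folded E_def]
  note S_norm = hinf_norm_error[OF graph U, of v, folded S]
  have "hinf_norm S = 1" if "CARD('m) \<ge> 2"
  proof -
    have "\<not> inj (\<lambda>_::'m. ())"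
      using card_inj_on_le[of "\<lambda>_::'m. ()" UNIV UNIV] that by auto
    then have "(onorm ((*v) (cmat (cell_residual ?U v))))\<^sup>2 = 1"
      using onorm_cell_residual[OF U(1) assms(3), of "\<lambda>_. ()"] by simp
    moreover have "0 \<le> onorm ((*v) (cmat (cell_residual ?U v)))"
      by (rule onorm_pos_le) simp
    ultimately show ?thesis
      using S_norm(2) by (simp add: power2_eq_1_iff one_ereal_def)
  qed
  moreover have "(hinf_norm E)\<^sup>2
      = ereal (if inj \<kappa> then (MAX i. 1 - 1 / real (card (C (\<kappa> i)))) else 1)"
    unfolding E_norm(2) onorm_cell_residual[OF assms(4,3,6), symmetric] by simp
  ultimately show ?thesis
    unfolding Let_def unfolding E_def[symmetric] unfolding S_def[symmetric]
    using E_norm(1) S_norm(1) by simp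
qed

end
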